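(* Let $\mathbf{X}\subseteq\Sigma^{\mathbb{Z}^2}$ be a subshift. Then $\mathbf{X}$ is uncountable if and only if at least one of the following two conditions holds: (1) there exist $x$ and $y$ in $\mathbf{X}$ such that $x\approx y$ and $x$ is not a shift of $y$; (2) there exists a complete tree of patterns for $\mathbf{X}$.
   Context: $\Sigma$ is a finite alphabet; a configuration is an element of $\Sigma^{\mathbb{Z}^2}$. For $v\in\mathbb{Z}^2$ the shift $\sigma_v$ is defined by $\sigma_v(x)(a)=x(a-v)$; $y$ is a shift of $x$ if $y=\sigma_v(x)$ for some $v\in\mathbb{Z}^2$. A pattern is an element $P\in\Sigma^V$ with $V\subset\mathbb{Z}^2$ finite; $P$ appears in a configuration $c$ if there is $v\in\mathbb{Z}^2$ with $c(a+v)=P(a)$ for all $a\in V$. A subshift is the set of all configurations in which no pattern of a given set $\mathcal{F}$ of patterns appears (equivalently, a closed shift-invariant subset of $\Sigma^{\mathbb{Z}^2}$ for the product topology of the discrete topology). Write $x\preceq y$ if every pattern appearing in $x$ appears in $y$, and $x\approx y$ if $x\preceq y$ and $y\preceq x$. A complete tree of patterns for $\mathbf{X}$ is an infinite (full) binary tree $T$, in which every node has a left son and a right son and is labelled by a pattern, such that for every infinite path $(u_i)_{i\in\mathbb{N}}$ in $T$ starting at the root there exists at least one configuration $c\in\mathbf{X}$ satisfying, for every $u_i$ in the path: if the path goes through the left son of $u_i$, then the pattern labelling $u_i$ appears in $c$; if the path goes through the right son of $u_i$, then the pattern labelling $u_i$ does not appear in $c$. *)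

theory Defs
  imports "HOL-Library.Finite_Map" "HOL-Library.Countable_Set" "HOL-Library.Product_Plus"
begin

type_synonym 'a config = "int \<times> int \<Rightarrow> 'a"

(* A pattern is a function defined on a finite set of cells. The empty pattern is allowed. *)
type_synonym 'a pattern = "(int \<times> int, 'a) fmap"

definition shift :: "int \<times> int \<Rightarrow> 'a config \<Rightarrow> 'a config" where
  "shift v x = (\<lambda>a. x (a - v))"

definition is_shift_of :: "'a config \<Rightarrow> 'a config \<Rightarrow> bool" where
  "is_shift_of y x \<longleftrightarrow> (\<exists>v. y = shift v x)"

definition appears_in :: "'a pattern \<Rightarrow> 'a config \<Rightarrow> bool" where
  "appears_in P c \<longleftrightarrow> (\<exists>v. \<forall>a \<in> fmdom' P. fmlookup P a = Some (c (a + v)))"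

definition subshift :: "'a config set \<Rightarrow> bool" where
  "subshift X \<longleftrightarrow> (\<exists>F :: 'a pattern set. X = {c. \<forall>P\<in>F. \<not> appears_in P c})"

definition pattern_le :: "'a config \<Rightarrow> 'a config \<Rightarrow> bool" where
  "pattern_le x y \<longleftrightarrow> (\<forall>P. appears_in P x \<longrightarrow> appears_in P y)"

definition pattern_equiv :: "'a config \<Rightarrow> 'a config \<Rightarrow> bool" where
  "pattern_equiv x y \<longleftrightarrow> pattern_le x y \<and> pattern_le y x"

(* A node of the full infinite binary tree is the finite sequence of turns leading to it from
   the root, with True for the left son and False for the right son; a labelled tree is
   therefore a function on bool lists. *)
type_synonym 'a pattern_tree = "bool list \<Rightarrow> 'a pattern"

(* The i-th node (the root for i = 0) of the infinite path with the sequence of turns d. *)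
definition path_node :: "(nat \<Rightarrow> bool) \<Rightarrow> nat \<Rightarrow> bool list" where
  "path_node d i = map d [0..<i]"

definition complete_pattern_tree :: "'a config set \<Rightarrow> 'a pattern_tree \<Rightarrow> bool" where
  "complete_pattern_tree X T \<longleftrightarrow>
     (\<forall>d. \<exists>c\<in>X. \<forall>i.
        (d i \<longrightarrow> appears_in (T (path_node d i)) c) \<and>
        (\<not> d i \<longrightarrow> \<not> appears_in (T (path_node d i)) c))"

end

theory Submission
  imports Defs "HOL-Analysis.Function_Topology"
begin

text \<open>
  Two facts carry the proof.  The space of configurations is compact and a subshift is closed
  in it, so decreasing sequences of nonempty closed sets have common points; and there are only
  countably many patterns.

  \<^emph>\<open>The conditions force uncountability.\<close>  The paths of a complete tree give pairwise distinct
  configurations: at the node where two paths part, one configuration contains the label and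
  the other does not.  If \<open>x \<approx> y\<close> are not shifts of each other, then any pattern of \<open>x\<close> also
  appears in \<open>y\<close>, hence occurs at the origin of the plane in a shift of \<open>x\<close> and in a shift of \<open>y\<close>.
  These two shifts differ, so at least one of them differs from any prescribed configuration \<open>z\<close>, and
  the pattern can be enlarged by one cell so as to exclude \<open>z\<close> (lemma \<open>extend_pattern_avoiding\<close>).
  Excluding the members of an enumeration one after the other and passing to the limit gives a
  configuration of the subshift outside the enumeration.

  \<^emph>\<open>Uncountability forces one of the conditions.\<close>  If equivalent configurations are always
  shifts of each other, the classes of \<open>\<approx>\<close> are countable, so uncountably many sets of patterns
  occur as languages of configurations.  An uncountable family of subsets of a countable set is
  split into two uncountable parts by the membership of some element
  (lemma \<open>uncountable_family_split\<close>); applied to languages this yields the label of a node, and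
  iterated, the tree.  The delicate point is the passage from finite to infinite paths: to
  contain a pattern is an open condition, and need not survive a limit.  One therefore asks on
  the left side for the pattern at a fixed position, which is a closed condition; countably many
  positions are available, so one of them retains uncountably many languages
  (lemma \<open>closed_set_split\<close>).
\<close>

section \<open>Patterns and configurations\<close>

definition occurs_at :: "'a pattern \<Rightarrow> int \<times> int \<Rightarrow> 'a config \<Rightarrow> bool" where
  "occurs_at P v c \<longleftrightarrow> (\<forall>a \<in> fmdom' P. fmlookup P a = Some (c (a + v)))"

definition language :: "'a config \<Rightarrow> 'a pattern set" where
  "language c = {P. appears_in P c}"

lemma appears_in_iff_occurs_at: "appears_in P c \<longleftrightarrow> (\<exists>v. occurs_at P v c)"
  by (simp add: appears_in_def occurs_at_def)

lemma pattern_equiv_iff_language: "pattern_equiv x y \<longleftrightarrow> language x = language y"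
  by (auto simp: pattern_equiv_def pattern_le_def language_def)

lemma occurs_at_shift: "occurs_at P v (shift w c) \<longleftrightarrow> occurs_at P (v - w) c"
  by (simp add: occurs_at_def shift_def add_diff_eq)

lemma appears_in_shift [simp]: "appears_in P (shift w c) \<longleftrightarrow> appears_in P c"
  unfolding appears_in_iff_occurs_at occurs_at_shift by (metis add_diff_cancel_right')

lemma appears_in_imp_shift_occurs_at_0:
  assumes "appears_in P c"
  obtains w where "occurs_at P 0 (shift w c)"
proof -
  obtain v where "occurs_at P v c"
    using assms by (auto simp: appears_in_iff_occurs_at)
  then have "occurs_at P 0 (shift (- v) c)"
    by (simp add: occurs_at_shift)
  then show thesis by (rule that)
qed

lemma subshift_shift_closed:
  assumes "subshift X" "c \<in> X"
  shows "shift w c \<in> X"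
  using assms unfolding subshift_def by auto

lemma is_shift_of_if_common_shift:
  assumes "shift v x = shift w y"
  shows "is_shift_of x y"
proof -
  have "x = shift (w - v) y"
  proof
    fix a
    have "x a = shift v x (a + v)" by (simp add: shift_def)
    also have "\<dots> = shift (w - v) y a"
      by (simp add: assms) (simp add: shift_def diff_diff_eq2)
    finally show "x a = shift (w - v) y a" .
  qed
  then show ?thesis unfolding is_shift_of_def by blast
qed

section \<open>Compactness of the space of configurations\<close>

abbreviation config_top :: "'a config topology" where
  "config_top \<equiv> product_topology (\<lambda>_. discrete_topology UNIV) UNIV"

lemma compact_space_config_top: "compact_space (config_top :: ('a :: finite) config topology)"
  by (simp add: compact_space_product_topology compact_space_discrete_topology)

lemma closedin_topspace_Int_INT:
  assumes "\<And>i. i \<in> I \<Longrightarrow> closedin T (S i)"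
  shows "closedin T (topspace T \<inter> (\<Inter>i\<in>I. S i))"
  using closedin_Inter[of "insert (topspace T) (S ` I)" T] assms by auto

lemma
  shows openin_cell: "openin config_top {c. Q (c a)}"
    and closedin_cell: "closedin config_top {c. Q (c a)}"
proof -
  have cont: "continuous_map config_top (discrete_topology UNIV) (\<lambda>c. c a)"
    by (rule continuous_map_product_projection) simp
  show "openin config_top {c. Q (c a)}"
    using openin_continuous_map_preimage[OF cont, of "{s. Q s}"] by simp
  show "closedin config_top {c. Q (c a)}"
    using closedin_continuous_map_preimage[OF cont, of "{s. Q s}"] by simp
qed

lemma occurs_at_eq_Inter:
  "{c. occurs_at P v c} =
    topspace config_top \<inter> (\<Inter>a\<in>fmdom' P. {c. fmlookup P a = Some (c (a + v))})"
  by (auto simp: occurs_at_def)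

lemma openin_occurs_at: "openin config_top {c. occurs_at P v c}"
  unfolding occurs_at_eq_Inter by (rule openin_Int_Inter[OF _ openin_topspace]) (auto intro: openin_cell)

lemma closedin_occurs_at: "closedin config_top {c. occurs_at P v c}"
  unfolding occurs_at_eq_Inter by (intro closedin_topspace_Int_INT) (auto intro: closedin_cell)

text \<open>That a pattern appears is an open condition, as a union of open conditions over the positions;
  its negation is therefore closed.\<close>

lemma closedin_not_appears_in: "closedin config_top {c. \<not> appears_in P c}"
proof -
  have "{c. \<not> appears_in P c} =
      topspace config_top \<inter> (\<Inter>v. topspace config_top - {c. occurs_at P v c})"
    by (auto simp: appears_in_iff_occurs_at)
  also have "closedin config_top \<dots>"
    by (intro closedin_topspace_Int_INT closedin_diff closedin_topspace openin_occurs_at)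
  finally show ?thesis .
qed

lemma closedin_subshift:
  assumes "subshift X"
  shows "closedin config_top X"
proof -
  obtain F where F: "X = {c. \<forall>P\<in>F. \<not> appears_in P c}"
    using assms unfolding subshift_def by blast
  have "X = topspace config_top \<inter> (\<Inter>P\<in>F. {c. \<not> appears_in P c})"
    unfolding F by auto
  also have "closedin config_top \<dots>"
    by (intro closedin_topspace_Int_INT closedin_not_appears_in)
  finally show ?thesis .
qed

lemma nested_closed_common_point:
  fixes C :: "nat \<Rightarrow> ('a :: finite) config set"
  assumes "\<And>n. closedin config_top (C n)" "\<And>n. C n \<noteq> {}" "\<And>n. C (Suc n) \<subseteq> C n"
  obtains c where "\<And>n. c \<in> C n"
proof -
  have "decseq C" using assms(3) by (rule decseq_SucI)
  then have "(\<Inter>n. C n) \<noteq> {}"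
    using assms(1,2) by (intro compact_space_imp_nest[OF compact_space_config_top]) auto
  then show thesis using that by blast
qed

section \<open>Equivalent configurations in different orbits\<close>

text \<open>One cell of the plane is enough to tell \<open>z\<close> apart from whichever of the two shifts differs
  from it; the enlarged pattern still appears in both \<open>x\<close> and \<open>y\<close>, because these have the same
  patterns.\<close>

lemma extend_pattern_avoiding:
  assumes equiv: "pattern_equiv x y" and not_shift: "\<not> is_shift_of x y"
    and P: "appears_in P x"
  obtains Q where "appears_in Q x" "\<And>c. occurs_at Q 0 c \<Longrightarrow> occurs_at P 0 c" "\<not> occurs_at Q 0 z"
proof -
  have same: "appears_in R x \<longleftrightarrow> appears_in R y" for R
    using equiv unfolding pattern_equiv_def pattern_le_def by blast
  obtain v where v: "occurs_at P 0 (shift v x)"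
    using P by (rule appears_in_imp_shift_occurs_at_0)
  obtain w where w: "occurs_at P 0 (shift w y)"
    using P unfolding same by (rule appears_in_imp_shift_occurs_at_0)
  have "shift v x \<noteq> shift w y"
    using is_shift_of_if_common_shift not_shift by blast
  then obtain c where c: "occurs_at P 0 c" "c \<noteq> z" "\<And>R. appears_in R c \<longleftrightarrow> appears_in R x"
    using v w same by (metis appears_in_shift)
  then obtain a where a: "c a \<noteq> z a" by blast
  define Q where "Q = fmupd a (c a) P"
  have "occurs_at Q 0 c"
    using c(1) by (auto simp: Q_def occurs_at_def)
  then have "appears_in Q x"
    using c(3)[of Q] appears_in_iff_occurs_at[of Q c] by blast
  moreover have "occurs_at P 0 d" if "occurs_at Q 0 d" for d
    using that c(1) by (auto simp: Q_def occurs_at_def split: if_splits)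
  moreover have "\<not> occurs_at Q 0 z"
    using a by (auto simp: Q_def occurs_at_def)
  ultimately show thesis using that by blast
qed

text \<open>The patterns \<open>P n\<close> grow, and \<open>P (n + 1)\<close> excludes the \<open>n\<close>-th member of the enumeration at
  the origin.  A configuration that has all of them there need not be a shift of \<open>x\<close> or \<open>y\<close>; it lies
  in \<open>X\<close> because \<open>X\<close> is closed.\<close>

lemma uncountable_if_equiv_not_shift:
  fixes X :: "('a :: finite) config set"
  assumes X: "subshift X" and x: "x \<in> X"
    and equiv: "pattern_equiv x y" "\<not> is_shift_of x y"
  shows "uncountable X"
proof
  assume "countable X"
  then have enum: "\<exists>n. c = from_nat_into X n" if "c \<in> X" for c
    using that by (metis from_nat_into_surj)
  have "\<exists>P. \<forall>n. appears_in (P n) x \<and>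
      ((\<forall>c. occurs_at (P (Suc n)) 0 c \<longrightarrow> occurs_at (P n) 0 c) \<and>
       \<not> occurs_at (P (Suc n)) 0 (from_nat_into X n))"
  proof (rule dependent_nat_choice)
    show "\<exists>P. appears_in P x"
      by (rule exI[of _ fmempty]) (simp add: appears_in_def)
  next
    fix P and n :: nat
    assume "appears_in P x"
    then obtain Q where "appears_in Q x" "\<And>c. occurs_at Q 0 c \<Longrightarrow> occurs_at P 0 c"
      "\<not> occurs_at Q 0 (from_nat_into X n)"
      using equiv extend_pattern_avoiding by metis
    then show "\<exists>Q. appears_in Q x \<and> ((\<forall>c. occurs_at Q 0 c \<longrightarrow> occurs_at P 0 c) \<and>
        \<not> occurs_at Q 0 (from_nat_into X n))"
      by blast
  qed
  then obtain P where P: "\<And>n. appears_in (P n) x"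
    "\<And>n c. occurs_at (P (Suc n)) 0 c \<Longrightarrow> occurs_at (P n) 0 c"
    "\<And>n. \<not> occurs_at (P (Suc n)) 0 (from_nat_into X n)"
    by blast
  define C where "C n = X \<inter> {c. occurs_at (P n) 0 c}" for n
  obtain c where c: "\<And>n. c \<in> C n"
  proof (rule nested_closed_common_point)
    show "closedin config_top (C n)" for n
      unfolding C_def using closedin_subshift[OF X] closedin_occurs_at by (rule closedin_Int)
    show "C n \<noteq> {}" for n
    proof -
      obtain w where "occurs_at (P n) 0 (shift w x)"
        using P(1) by (rule appears_in_imp_shift_occurs_at_0)
      then show ?thesis
        using subshift_shift_closed[OF X x] unfolding C_def by blast
    qed
    show "C (Suc n) \<subseteq> C n" for n
      using P(2) unfolding C_def by blast
  qed blast
  then have "c \<in> X" by (simp add: C_def)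
  then obtain n where "c = from_nat_into X n" using enum by blast
  then show False using P(3)[of n] c[of "Suc n"] by (simp add: C_def)
qed

section \<open>Complete trees of patterns\<close>

lemma complete_pattern_tree_iff:
  "complete_pattern_tree X T \<longleftrightarrow> (\<forall>d. \<exists>c\<in>X. \<forall>i. appears_in (T (path_node d i)) c \<longleftrightarrow> d i)"
proof -
  have "(b \<longrightarrow> a) \<and> (\<not> b \<longrightarrow> \<not> a) \<longleftrightarrow> (a \<longleftrightarrow> b)" for a b by blast
  then show ?thesis unfolding complete_pattern_tree_def by (simp only:)
qed

lemma uncountable_if_complete_pattern_tree:
  assumes "complete_pattern_tree X T"
  shows "uncountable X"
proof
  assume X: "countable X"
  obtain f where f: "\<And>d. f d \<in> X" "\<And>d i. appears_in (T (path_node d i)) (f d) \<longleftrightarrow> d i"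
    using assms unfolding complete_pattern_tree_iff Bex_def choice_iff by blast
  have "d i = e i" if "f d = f e" for d e i
  proof (induction i rule: less_induct)
    case (less i)
    then have "path_node d i = path_node e i" by (simp add: path_node_def)
    then show ?case using f(2)[of d i] f(2)[of e i] that by simp
  qed
  then have "inj f" by (intro injI ext)
  moreover have "countable (range f)"
    using X by (rule countable_subset[rotated]) (use f(1) in blast)
  ultimately have "countable (UNIV :: (nat \<Rightarrow> bool) set)"
    using countable_image_inj_on by blast
  \<comment> \<open>Cantor's diagonal argument.\<close>
  then have "\<exists>n. from_nat_into UNIV n = (\<lambda>n. \<not> from_nat_into (UNIV :: (nat \<Rightarrow> bool) set) n n)"
    by (rule from_nat_into_surj) (rule UNIV_I)
  then obtain n where "from_nat_into UNIV n = (\<lambda>n. \<not> from_nat_into (UNIV :: (nat \<Rightarrow> bool) set) n n)"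
    by (rule exE)
  from fun_cong[OF this, of n] show False by simp
qed

text \<open>If every element had a countable side, then outside the countable union of these sides
  membership of each element would be prescribed, which leaves a single set.\<close>

lemma uncountable_family_split:
  fixes L :: "('p :: countable) set set"
  assumes "uncountable L"
  obtains p where "uncountable {A \<in> L. p \<in> A}" "uncountable {A \<in> L. p \<notin> A}"
proof (rule ccontr)
  assume "\<not> thesis"
  then have one: "countable {A \<in> L. p \<in> A} \<or> countable {A \<in> L. p \<notin> A}" for p
    using that by blast
  \<comment> \<open>\<open>S p\<close> is a countable side of \<open>p\<close>.\<close>
  define S where "S p = (if countable {A \<in> L. p \<in> A} then {A \<in> L. p \<in> A} else {A \<in> L. p \<notin> A})" for p
  have "countable (S p)" for p
    using one unfolding S_def by auto
  then have "countable (insert {p. uncountable {A \<in> L. p \<in> A}} (\<Union>p. S p))"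
    by (intro countable_insert countable_UN countableI_type)
  moreover have "L \<subseteq> insert {p. uncountable {A \<in> L. p \<in> A}} (\<Union>p. S p)"
  proof
    fix A assume A: "A \<in> L"
    have "p \<in> A \<longleftrightarrow> uncountable {A \<in> L. p \<in> A}" if "A \<notin> S p" for p
      using A that unfolding S_def by (cases "countable {A \<in> L. p \<in> A}") simp_all
    then show "A \<in> insert {p. uncountable {A \<in> L. p \<in> A}} (\<Union>p. S p)" by blast
  qed
  ultimately have "countable L" by (rule countable_subset[rotated])
  then show False using assms by blast
qed

text \<open>The tree is grown from closed sets with uncountably many languages: such a set is nonempty,
  and closedness is what survives along an infinite path.\<close>

definition rich_closed :: "'a config set \<Rightarrow> bool" where
  "rich_closed K \<longleftrightarrow> closedin config_top K \<and> uncountable (language ` K)"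

lemma closed_set_split:
  fixes K :: "('a :: finite) config set"
  assumes "rich_closed K"
  obtains P v where "rich_closed (K \<inter> {c. occurs_at P v c})" "rich_closed (K \<inter> {c. \<not> appears_in P c})"
proof -
  have K: "closedin config_top K" "uncountable (language ` K)"
    using assms unfolding rich_closed_def by auto
  obtain P where P: "uncountable {A \<in> language ` K. P \<in> A}" "uncountable {A \<in> language ` K. P \<notin> A}"
    using K(2) by (rule uncountable_family_split)
  have "{A \<in> language ` K. P \<in> A} = (\<Union>v. language ` (K \<inter> {c. occurs_at P v c}))"
    unfolding language_def appears_in_iff_occurs_at by blast
  then have "\<not> (\<forall>v. countable (language ` (K \<inter> {c. occurs_at P v c})))"
    using P(1) by auto
  then obtain v where "uncountable (language ` (K \<inter> {c. occurs_at P v c}))"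
    by blast
  moreover have "{A \<in> language ` K. P \<notin> A} = language ` (K \<inter> {c. \<not> appears_in P c})"
    unfolding language_def by blast
  ultimately show thesis
    using P(2) closedin_Int[OF K(1) closedin_occurs_at] closedin_Int[OF K(1) closedin_not_appears_in]
    by (intro that[of P v]) (simp_all add: rich_closed_def)
qed

text \<open>The sets \<open>K u\<close> shrink along each path, so by compactness they have a common configuration,
  and membership in the successor of \<open>K u\<close> already decides the label of \<open>u\<close> as the path requires.
  Labels depend on \<open>u\<close> only through \<open>K u\<close>, which turns the recursion into a fold along the
  turns.\<close>

lemma complete_pattern_tree_if_rich_closed:
  fixes X :: "('a :: finite) config set"
  assumes "rich_closed X"
  obtains T where "complete_pattern_tree X T"
proof -
  obtain lab pos where split: "\<And>K :: 'a config set. rich_closed K \<Longrightarrow>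
      rich_closed (K \<inter> {c. occurs_at (lab K) (pos K) c}) \<and> rich_closed (K \<inter> {c. \<not> appears_in (lab K) c})"
    using closed_set_split by metis
  define step where "step K b =
    (if b then K \<inter> {c. occurs_at (lab K) (pos K) c} else K \<inter> {c. \<not> appears_in (lab K) c})" for K b
  define K where "K u = foldl step X u" for u
  have rich: "rich_closed (K u)" for u
    by (induction u rule: rev_induct) (use assms split in \<open>auto simp: K_def step_def\<close>)
  have "\<exists>c\<in>X. \<forall>i. appears_in (lab (K (path_node d i))) c \<longleftrightarrow> d i" for d
  proof -
    have Suc: "K (path_node d (Suc i)) = step (K (path_node d i)) (d i)" for i
      by (simp add: K_def path_node_def)
    obtain c where c: "\<And>i. c \<in> K (path_node d i)"
    proof (rule nested_closed_common_point)
      show "closedin config_top (K (path_node d i))" for i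
        using rich unfolding rich_closed_def by blast
      show "K (path_node d i) \<noteq> {}" for i
        using rich[of "path_node d i"] unfolding rich_closed_def by auto
      show "K (path_node d (Suc i)) \<subseteq> K (path_node d i)" for i
        unfolding Suc step_def by auto
    qed blast
    have "c \<in> X"
      using c[of 0] by (simp add: K_def path_node_def)
    moreover have "appears_in (lab (K (path_node d i))) c \<longleftrightarrow> d i" for i
      using c[of "Suc i"] unfolding Suc step_def
      unfolding appears_in_iff_occurs_at by (cases "d i") (simp_all del: split_paired_All split_paired_Ex, blast)
    ultimately show ?thesis by blast
  qed
  then have "complete_pattern_tree X (\<lambda>u. lab (K u))"
    unfolding complete_pattern_tree_iff by blast
  then show thesis by (rule that)
qed

text \<open>Configurations with one language form a single orbit here, and orbits are countable because
  the group of translations is.\<close>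

lemma uncountable_languages:
  assumes X: "uncountable X"
    and shifts: "\<And>x y. x \<in> X \<Longrightarrow> y \<in> X \<Longrightarrow> pattern_equiv x y \<Longrightarrow> is_shift_of x y"
  shows "uncountable (language ` X)"
proof
  assume "countable (language ` X)"
  moreover have "countable {x \<in> X. language x = A}" if "A \<in> language ` X" for A
  proof -
    obtain y where y: "y \<in> X" "A = language y" using \<open>A \<in> language ` X\<close> by blast
    then have "{x \<in> X. language x = A} \<subseteq> range (\<lambda>v. shift v y)"
      using shifts unfolding pattern_equiv_iff_language is_shift_of_def by blast
    then show ?thesis by (rule countable_subset) simp
  qed
  ultimately have "countable (\<Union>A\<in>language ` X. {x \<in> X. language x = A})"
    by (rule countable_UN)
  moreover have "X \<subseteq> (\<Union>A\<in>language ` X. {x \<in> X. language x = A})" by blast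
  ultimately show False using X countable_subset by blast
qed

section \<open>The dichotomy\<close>

theorem theorem3p4:
  fixes X :: "('a :: finite) config set"
  assumes "subshift X"
  shows "uncountable X \<longleftrightarrow>
    (\<exists>x\<in>X. \<exists>y\<in>X. pattern_equiv x y \<and> \<not> is_shift_of x y) \<or>
    (\<exists>T. complete_pattern_tree X T)"
proof
  assume X: "uncountable X"
  show "(\<exists>x\<in>X. \<exists>y\<in>X. pattern_equiv x y \<and> \<not> is_shift_of x y) \<or>
    (\<exists>T. complete_pattern_tree X T)"
  proof (intro disj_imp[THEN iffD2] impI)
    assume "\<not> (\<exists>x\<in>X. \<exists>y\<in>X. pattern_equiv x y \<and> \<not> is_shift_of x y)"
    then have "rich_closed X"
      unfolding rich_closed_def
      using closedin_subshift[OF assms] uncountable_languages[OF X] by blast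
    then show "\<exists>T. complete_pattern_tree X T"
      using complete_pattern_tree_if_rich_closed by blast
  qed
next
  assume "(\<exists>x\<in>X. \<exists>y\<in>X. pattern_equiv x y \<and> \<not> is_shift_of x y) \<or>
    (\<exists>T. complete_pattern_tree X T)"
  then show "uncountable X"
    using uncountable_if_equiv_not_shift[OF assms] uncountable_if_complete_pattern_tree by blast
qed

end
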